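(* Let $n\ge 1$, let $R\in\mathcal{R}$ be a nondegenerate convex reflector in $\mathbb{R}^{n+1}$, and let $D(R)$ be its directrix. Then: 1. $D(R)$ is a closed convex hypersurface with the origin $\mathcal{O}$ in the interior of the compact convex body bounded by $D(R)$; 2. for any paraboloid $P(y)$ supporting to $R$, the vector $-y$ is the outward unit normal to a hyperplane supporting to $D(R)$; the hyperplanes supporting to $D(R)$ are the directrix hyperplanes of paraboloids supporting to $R$; 3. the support function $H$ of $D(R)$ satisfies $$H(-y)=p(y),\qquad y\in S^n,$$ where $p$ is the focal function of $R$; 4. $D(R)$ can be parametrized as $$r^D(u)=2h(u)u,\qquad u\in S^n,$$ where $h$ is the support function of $R$. In this parametrization $D(R)$ is of class $C^1$.
   Context: Fix the origin $\mathcal{O}$ of $\mathbb{R}^{n+1}$, $n\ge 1$; $S^n$ is the unit sphere centered at $\mathcal{O}$. Paraboloids: "paraboloid" always means a paraboloid of revolution with focus $\mathcal{O}$ and axis direction $y\in S^n$ pointing towards its opening. It is denoted $P(y)$; its polar equation is $\rho_y(x)=\tilde p/(1-\langle x,y\rangle)$, $x\in S^n\setminus\{y\}$, where $\tilde p\ge 0$ is its focal parameter. Equivalently, $P(y)=\{X\in\mathbb{R}^{n+1}: |X|-\langle X,y\rangle=\tilde p\}$. $B(y)=\{X: |X|-\langle X,y\rangle\le\tilde p\}$ is the closed convex set bounded by $P(y)$ and containing its axis. If $\tilde p=0$ the paraboloid is degenerate (the ray from $\mathcal{O}$ in direction $y$); if $\tilde p=\infty$ it is improper and $B(y)=\mathbb{R}^{n+1}$.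 The directrix hyperplane of the paraboloid $P(y)$ with focal parameter $\tilde p\in(0,\infty)$ is $\{Z\in\mathbb{R}^{n+1}:\langle Z,-y\rangle=\tilde p\}$. Reflectors: given a family $\{P(y): y\in S^n\}$ (one paraboloid for each $y$, with focal parameters $\tilde p(y)\in[0,\infty]$), put $B=\bigcap_{y\in S^n}B(y)$ and $R=\partial B$. If $B$ is compact with nonempty interior in $\mathbb{R}^{n+1}$, then $R$ is called a (nondegenerate) convex reflector with light source $\mathcal{O}$. The set of all nondegenerate convex reflectors with light source $\mathcal{O}$ is denoted $\mathcal{R}$. For $R\in\mathcal{R}$, $B(R)$ denotes the compact convex body bounded by $R$; $\mathcal{O}$ is an interior point of $B(R)$. A paraboloid $P(y)$ is supporting to a set $A\subset\mathbb{R}^{n+1}$ if $A\subset B(y)$ and $P(y)\cap A\ne\emptyset$; it is supporting to $A$ at $X$ if moreover $X\in P(y)\cap A$. It is known that for each $R\in\mathcal{R}$ and each $y\in S^n$ there is a unique paraboloid $P(y)$ supporting to $R$ (not necessarily from the family defining $R$). The focal function $p:S^n\to\mathbb{R}$ of $R$ assigns to $y$ the focal parameter of the paraboloid $P(y)$ supporting to $R$. Radial function: $\rho(x)=\sup\{\lambda\ge 0:\lambda x\in B(R)\}$, $x\in S^n$, and $r(x)=\rho(x)x\in R$. Reflector map (possibly multivalued): $\gamma(x)$ is the set of all $y\in S^n$ that are axes of paraboloids supporting to $R$ at $r(x)$; equivalently $\gamma(x)=\{y\in S^n: p(y)=\rho(x)(1-\langle x,y\rangle)\}$. Directrix: for $x\in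 S^n$ put $D_x(R)=\{r(x)-\rho(x)y: y\in\gamma(x)\}$, and $D(R)=\bigcup_{x\in S^n}D_x(R)$. Support functions: the support function of a closed convex hypersurface that bounds a compact convex body $K$ is $u\mapsto\sup_{X\in K}\langle X,u\rangle$, $u\in S^n$; in particular $h(u)=\sup_{X\in B(R)}\langle X,u\rangle$. *)

theory Defs
  imports "HOL-Analysis.Analysis"
begin

(* The origin of the ambient space is 0 and the unit sphere is sphere 0 1.
   A paraboloid of revolution with focus 0 is given by its unit axis vector y
   (pointing towards the opening) and its focal parameter q in [0, infinity].
   For a unit vector y the quantity norm X - X \<bullet> y is nonnegative, so the embedding
   into ennreal does not truncate. *)

definition paraboloid :: "'a::euclidean_space \<Rightarrow> ennreal \<Rightarrow> 'a set" where
  "paraboloid y q = {X. ennreal (norm X - X \<bullet> y) = q}"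

definition paraboloid_body :: "'a::euclidean_space \<Rightarrow> ennreal \<Rightarrow> 'a set" where
  "paraboloid_body y q = {X. ennreal (norm X - X \<bullet> y) \<le> q}"

(* Meaningful for 0 < q < infinity. *)
definition directrix_hyperplane :: "'a::euclidean_space \<Rightarrow> ennreal \<Rightarrow> 'a set" where
  "directrix_hyperplane y q = {Z. Z \<bullet> (- y) = enn2real q}"

definition supporting_paraboloid :: "'a::euclidean_space \<Rightarrow> ennreal \<Rightarrow> 'a set \<Rightarrow> bool" where
  "supporting_paraboloid y q A \<longleftrightarrow>
     y \<in> sphere 0 1 \<and> A \<subseteq> paraboloid_body y q \<and> paraboloid y q \<inter> A \<noteq> {}"

definition supporting_paraboloid_at ::
    "'a::euclidean_space \<Rightarrow> ennreal \<Rightarrow> 'a set \<Rightarrow> 'a \<Rightarrow> bool" where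
  "supporting_paraboloid_at y q A X \<longleftrightarrow>
     supporting_paraboloid y q A \<and> X \<in> paraboloid y q \<inter> A"

definition convex_body :: "'a::euclidean_space set \<Rightarrow> bool" where
  "convex_body K \<longleftrightarrow> compact K \<and> convex K \<and> interior K \<noteq> {}"

definition closed_convex_hypersurface :: "'a::euclidean_space set \<Rightarrow> bool" where
  "closed_convex_hypersurface S \<longleftrightarrow> (\<exists>K. convex_body K \<and> frontier K = S)"

(* Unique when it exists: a compact convex set is the convex hull of its frontier. *)
definition body_bounded_by :: "'a::euclidean_space set \<Rightarrow> 'a set" where
  "body_bounded_by S = (THE K. convex_body K \<and> frontier K = S)"

definition support_function :: "'a::euclidean_space set \<Rightarrow> 'a \<Rightarrow> real" where
  "support_function S u = (SUP X\<in>body_bounded_by S. X \<bullet> u)"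

definition supporting_hyperplane :: "'a::euclidean_space set \<Rightarrow> 'a set \<Rightarrow> 'a \<Rightarrow> bool" where
  \<comment> \<open>\<open>H\<close> is a hyperplane supporting to \<open>S\<close>, with outward unit normal \<open>u\<close>\<close>
  "supporting_hyperplane S H u \<longleftrightarrow>
     norm u = 1 \<and> (\<exists>c. H = {Z. Z \<bullet> u = c} \<and> S \<subseteq> {Z. Z \<bullet> u \<le> c} \<and> H \<inter> S \<noteq> {})"

definition nondegenerate_reflectors :: "'a::euclidean_space set set" where
  "nondegenerate_reflectors =
     {R. \<exists>q :: 'a \<Rightarrow> ennreal.
        compact (\<Inter>y\<in>sphere 0 1. paraboloid_body y (q y)) \<and>
        interior (\<Inter>y\<in>sphere 0 1. paraboloid_body y (q y)) \<noteq> {} \<and>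
        R = frontier (\<Inter>y\<in>sphere 0 1. paraboloid_body y (q y))}"

definition focal_function :: "'a::euclidean_space set \<Rightarrow> 'a \<Rightarrow> real" where
  "focal_function R y = enn2real (THE q. supporting_paraboloid y q R)"

definition radial_function :: "'a::euclidean_space set \<Rightarrow> 'a \<Rightarrow> real" where
  "radial_function R x = Sup {t. 0 \<le> t \<and> t *\<^sub>R x \<in> body_bounded_by R}"

definition radial_point :: "'a::euclidean_space set \<Rightarrow> 'a \<Rightarrow> 'a" where
  "radial_point R x = radial_function R x *\<^sub>R x"

definition reflector_map :: "'a::euclidean_space set \<Rightarrow> 'a \<Rightarrow> 'a set" where
  "reflector_map R x =
     {y \<in> sphere 0 1. \<exists>q. supporting_paraboloid_at y q R (radial_point R x)}"

definition directrix_at :: "'a::euclidean_space set \<Rightarrow> 'a \<Rightarrow> 'a set" where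
  "directrix_at R x =
     (\<lambda>y. radial_point R x - radial_function R x *\<^sub>R y) ` reflector_map R x"

definition directrix :: "'a::euclidean_space set \<Rightarrow> 'a set" where
  "directrix R = (\<Union>x\<in>sphere 0 1. directrix_at R x)"

(* A C^1 immersion of the unit sphere: f extends to a continuously differentiable map F
   on a neighbourhood of the sphere, and its differential is injective on each tangent
   space {v. v \<bullet> u = 0} of the sphere. On the tangent spaces the derivative of F does not
   depend on the choice of the extension. *)
definition C1_immersion_of_sphere :: "('a::euclidean_space \<Rightarrow> 'b::euclidean_space) \<Rightarrow> bool" where
  "C1_immersion_of_sphere f \<longleftrightarrow>
     (\<exists>U F. \<exists>F' :: 'a \<Rightarrow> 'a \<Rightarrow>\<^sub>L 'b.
        open U \<and> sphere 0 1 \<subseteq> U \<and> (\<forall>u\<in>sphere 0 1. F u = f u) \<and>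
        (\<forall>x\<in>U. (F has_derivative blinfun_apply (F' x)) (at x)) \<and>
        continuous_on U F' \<and>
        (\<forall>u\<in>sphere 0 1. inj_on (blinfun_apply (F' u)) {v. v \<bullet> u = 0}))"

end

(* The body bounded by the directrix is the union of the balls with centre X in B(R) and radius
   |X|, i.e. of the balls with the origin on their boundary. The support function of the ball with
   centre X at -y is |X| - <X,y>, whose supremum over B(R) is the focal function p(y). The ball
   condition Z.Z <= 2 <X,Z> shows that the union is {Z. Z.Z <= 2 h(Z)} with h extended
   homogeneously, which is bounded by the radial graph u |-> 2 h(u) u. Since B(R) is an
   intersection of paraboloid bodies, it consists of all X whose ball lies in the convex hull of
   the union; this makes the union convex. The paraboloids are strictly convex, so each u has a
   unique point of B(R) at which h(u) is attained; it depends continuously on u and is the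
   gradient of h. *)

theory Submission
  imports Defs
begin

section \<open>Suprema over compact sets, radial tests and rays\<close>

lemma compact_SUP_attained:
  fixes f :: "'a::topological_space \<Rightarrow> real"
  assumes "compact B" "B \<noteq> {}" "continuous_on B f"
  obtains X where "X \<in> B" "f X = (SUP X\<in>B. f X)" "\<And>Y. Y \<in> B \<Longrightarrow> f Y \<le> (SUP X\<in>B. f X)"
proof -
  obtain X where X: "X \<in> B" "\<forall>Y\<in>B. f Y \<le> f X"
    using continuous_attains_sup[OF assms] by blast
  then have "f X = (SUP X\<in>B. f X)"
    by (intro cSup_eq_maximum[symmetric]) auto
  with X show thesis
    by (intro that[of X]) auto
qed

text \<open>Each \<open>f X + X \<bullet> u\<close> is Lipschitz in \<open>u\<close> with constant
  \<open>norm X\<close>, and the supremum inherits the common bound \<open>M\<close>. With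
  \<open>f\<close> zero this serves the support function, with \<open>f = norm\<close> the focal
  function.\<close>

lemma continuous_on_SUP_affine:
  fixes B :: "'a::euclidean_space set" and f :: "'a \<Rightarrow> real"
  assumes "compact B" "B \<noteq> {}" "continuous_on B f"
  shows "continuous_on UNIV (\<lambda>u. SUP X\<in>B. f X + X \<bullet> u)"
proof -
  define s where "s u = (SUP X\<in>B. f X + X \<bullet> u)" for u
  obtain M where M: "M > 0" "\<And>X. X \<in> B \<Longrightarrow> norm X \<le> M"
    using compact_imp_bounded[OF assms(1)] bounded_pos by blast
  have *: "s u \<le> s v + M * norm (u - v)" for u v
  proof -
    have cont: "continuous_on B (\<lambda>X. f X + X \<bullet> w)" for w
      by (intro continuous_intros assms)
    obtain X where X: "X \<in> B" "f X + X \<bullet> u = s u"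
      using compact_SUP_attained[OF assms(1,2) cont[of u]] unfolding s_def by metis
    have "f X + X \<bullet> v \<le> s v"
      using compact_SUP_attained[OF assms(1,2) cont[of v]] X(1) unfolding s_def by metis
    moreover have "X \<bullet> u - X \<bullet> v \<le> M * norm (u - v)"
      using norm_cauchy_schwarz[of X "u - v"] mult_right_mono[OF M(2)[OF X(1)], of "norm (u - v)"]
      by (simp add: inner_diff_right)
    ultimately show ?thesis using X(2) by simp
  qed
  have "M-lipschitz_on UNIV s"
  proof (rule lipschitz_onI)
    show "dist (s u) (s v) \<le> M * dist u v" for u v
      using *[of u v] *[of v u] by (auto simp: dist_norm norm_minus_commute abs_le_iff)
  qed (use M in auto)
  then show ?thesis
    using lipschitz_on_continuous_on unfolding s_def by blast
qed

lemma body_bounded_by_frontier: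
  assumes "convex_body K"
  shows "body_bounded_by (frontier K) = K"
  unfolding body_bounded_by_def
proof (rule the_equality)
  show "L = K" if "convex_body L \<and> frontier L = frontier K" for L
    using that assms Krein_Milman_frontier[of K] Krein_Milman_frontier[of L]
    unfolding convex_body_def by metis
qed (use assms in simp)

text \<open>A ball around \<open>Z\<close> would contain \<open>(1 + d) *\<^sub>R Z\<close> for
  small positive \<open>d\<close>. Boundary points are recognised below by this radial test.\<close>

lemma scaleR_notin_interior:
  fixes K :: "'a::real_normed_vector set"
  assumes "\<And>t. t > 1 \<Longrightarrow> t *\<^sub>R Z \<notin> K"
  shows "Z \<notin> interior K"
proof
  assume "Z \<in> interior K"
  then obtain e where e: "e > 0" "ball Z e \<subseteq> K"
    using mem_interior by blast
  \<comment> \<open>The summand 1 keeps the quotient meaningful at \<open>Z = 0\<close> and makes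
    \<open>d * norm Z < e\<close> strict.\<close>
  define d where "d = e / (norm Z + 1)"
  have d: "d > 0" using e by (simp add: d_def add_nonneg_pos)
  have "d * norm Z < d * (norm Z + 1)" using d by simp
  also have "\<dots> = e" by (simp add: d_def add_nonneg_eq_0_iff)
  finally have "d * norm Z < e" .
  moreover have "(1 + d) *\<^sub>R Z - Z = d *\<^sub>R Z" by (simp add: algebra_simps)
  ultimately have "(1 + d) *\<^sub>R Z \<in> ball Z e"
    unfolding mem_ball dist_commute[of Z] using d by (simp add: dist_norm)
  then show False using assms[of "1 + d"] d e by auto
qed

text \<open>Equality case of Cauchy-Schwarz. It confines a degenerate paraboloid body to a ray and
  later identifies the reflected direction.\<close>

lemma norm_le_inner_unitD:
  fixes X y :: "'a::real_inner"
  assumes "norm y = 1" "norm X \<le> X \<bullet> y"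
  shows "X = norm X *\<^sub>R y"
  using assms norm_cauchy_schwarz[of X y] norm_cauchy_schwarz_eq[of X y] by simp

text \<open>All of \<open>B\<close> lies on the ray along \<open>y\<close>, and a small shift
  orthogonal to \<open>y\<close> leaves that ray. Dimension at least two supplies the orthogonal
  direction.\<close>

lemma interior_ray_empty:
  fixes B :: "'a::euclidean_space set"
  assumes "DIM('a) \<ge> 2" "norm y = 1" "\<And>X. X \<in> B \<Longrightarrow> norm X \<le> X \<bullet> y"
  shows "interior B = {}"
proof (rule ccontr)
  assume "interior B \<noteq> {}"
  then obtain X where "X \<in> interior B" by blast
  then obtain e where e: "e > 0" "ball X e \<subseteq> B"
    using mem_interior by blast
  obtain v where v: "v \<noteq> 0" "orthogonal y v"
    using assms(1) orthogonal_to_vector_exists by blast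
  define w where "w = (e / 2 / norm v) *\<^sub>R v"
  have w: "w \<noteq> 0" "y \<bullet> w = 0" "norm w < e"
    using v e by (auto simp: w_def orthogonal_def)
  have "X \<in> B" "X + w \<in> B"
    using e w by (auto simp: subset_iff dist_norm)
  then have "X = norm X *\<^sub>R y" "X + w = norm (X + w) *\<^sub>R y"
    using norm_le_inner_unitD assms by blast+
  then have "w = (norm (X + w) - norm X) *\<^sub>R y"
    by (metis add_diff_cancel_left' scaleR_left_diff_distrib)
  then have "w \<bullet> w = 0"
    using w(2) by (metis inner_scaleR_left mult_zero_right)
  then show False using w by simp
qed

lemma focal_scaleR:
  fixes X y :: "'a::real_inner"
  assumes "t \<ge> 0"
  shows "norm (t *\<^sub>R X) - (t *\<^sub>R X) \<bullet> y = t * (norm X - X \<bullet> y)"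
  using assms by (simp add: right_diff_distrib)

text \<open>The square of \<open>norm X\<close> cancels, so for fixed \<open>Z\<close> the condition
  is linear in the centre \<open>X\<close>; this is how the support function enters.\<close>

lemma norm_diff_le_norm_iff:
  fixes X Z :: "'a::real_inner"
  shows "norm (X - Z) \<le> norm X \<longleftrightarrow> Z \<bullet> Z \<le> 2 * (X \<bullet> Z)"
  unfolding norm_le by (simp add: inner_diff inner_commute)

text \<open>By \<open>mem_BI\<close>, \<open>B\<close> is the intersection of its own supporting
  paraboloid bodies; the arbitrary family defining a reflector is thus replaced by the focal
  function.\<close>

locale reflector_body =
  fixes B :: "'a::euclidean_space set" and p h :: "'a \<Rightarrow> real"
  defines "p \<equiv> \<lambda>y. SUP X\<in>B. norm X - X \<bullet> y"
    and "h \<equiv> \<lambda>u. SUP X\<in>B. X \<bullet> u"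
  assumes compact_B: "compact B"
    and zero_interior_B: "0 \<in> interior B"
    and mem_BI: "(\<And>y. norm y = 1 \<Longrightarrow> norm X - X \<bullet> y \<le> p y) \<Longrightarrow> X \<in> B"
begin

section \<open>Focal and support functions of the reflector body\<close>

lemma B_nonempty: "B \<noteq> {}"
  using zero_interior_B interior_subset by blast

lemma
  shows p_attained: "\<exists>X\<in>B. norm X - X \<bullet> y = p y"
    and le_p: "X \<in> B \<Longrightarrow> norm X - X \<bullet> y \<le> p y"
proof -
  have "continuous_on B (\<lambda>X. norm X - X \<bullet> y)" by (intro continuous_intros)
  from compact_SUP_attained[OF compact_B B_nonempty this]
  show "\<exists>X\<in>B. norm X - X \<bullet> y = p y" "X \<in> B \<Longrightarrow> norm X - X \<bullet> y \<le> p y"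
    unfolding p_def by metis+
qed

lemma
  shows h_attained: "\<exists>X\<in>B. X \<bullet> u = h u"
    and le_h: "X \<in> B \<Longrightarrow> X \<bullet> u \<le> h u"
proof -
  have "continuous_on B (\<lambda>X. X \<bullet> u)" by (intro continuous_intros)
  from compact_SUP_attained[OF compact_B B_nonempty this]
  show "\<exists>X\<in>B. X \<bullet> u = h u" "X \<in> B \<Longrightarrow> X \<bullet> u \<le> h u"
    unfolding h_def by metis+
qed

lemma continuous_on_h: "continuous_on UNIV h"
  using continuous_on_SUP_affine[OF compact_B B_nonempty, of "\<lambda>_. 0"] by (simp add: h_def)

lemma h_scaleR:
  assumes "t \<ge> 0"
  shows "h (t *\<^sub>R u) = t * h u"
proof (rule antisym)
  obtain X where X: "X \<in> B" "X \<bullet> (t *\<^sub>R u) = h (t *\<^sub>R u)" using h_attained by blast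
  then show "h (t *\<^sub>R u) \<le> t * h u"
    using le_h[OF X(1), of u] assms by (metis inner_scaleR_right mult_left_mono)
  obtain X where X: "X \<in> B" "X \<bullet> u = h u" using h_attained by blast
  then show "t * h u \<le> h (t *\<^sub>R u)"
    using le_h[OF X(1), of "t *\<^sub>R u"] by (metis inner_scaleR_right)
qed

lemma ball_bound:
  obtains e where "e > 0" "cball 0 e \<subseteq> B"
  using zero_interior_B mem_interior_cball by blast

text \<open>A ball of radius \<open>e\<close> around 0 lies in \<open>B\<close>, and its support
  function is \<open>e * norm u\<close>.\<close>

lemma h_lower:
  obtains e where "e > 0" "\<And>u. e * norm u \<le> h u"
proof -
  obtain e where e: "e > 0" "cball 0 e \<subseteq> B" by (rule ball_bound)
  have "e * norm u \<le> h u" for u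
  proof (cases "u = 0")
    case True
    then show ?thesis using h_scaleR[of 0 u] by simp
  next
    case False
    have "(e / norm u) *\<^sub>R u \<in> B" using e False by (auto simp: subset_iff)
    then have "((e / norm u) *\<^sub>R u) \<bullet> u \<le> h u" by (rule le_h)
    then show ?thesis using False by (simp add: dot_square_norm power2_eq_square)
  qed
  with e(1) show thesis using that by blast
qed

lemma h_pos: "u \<noteq> 0 \<Longrightarrow> h u > 0"
  by (rule h_lower) (metis mult_pos_pos order_less_le_trans zero_less_norm_iff)

lemma h_pos_unit: "norm u = 1 \<Longrightarrow> h u > 0"
  by (rule h_pos) auto

lemma p_pos:
  assumes "norm y = 1"
  shows "p y > 0"
proof -
  obtain e where e: "e > 0" "cball 0 e \<subseteq> B" by (rule ball_bound)
  \<comment> \<open>At this point, opposite to the axis, the focal expression equals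
    \<open>2 * e\<close>.\<close>
  then have "- e *\<^sub>R y \<in> B" using assms by (auto simp: subset_iff)
  from le_p[OF this, of y] show ?thesis using e assms by (simp add: dot_square_norm)
qed

lemma convex_B: "convex B"
proof (rule convexI)
  fix X Y u v :: real and a b :: 'a
  assume ab: "a \<in> B" "b \<in> B" and uv: "0 \<le> u" "0 \<le> v" "u + v = 1"
  show "u *\<^sub>R a + v *\<^sub>R b \<in> B"
  proof (rule mem_BI)
    fix y :: 'a assume "norm y = 1"
    have "norm (u *\<^sub>R a + v *\<^sub>R b) \<le> u * norm a + v * norm b"
      using norm_triangle_ineq[of "u *\<^sub>R a" "v *\<^sub>R b"] uv by simp
    then have "norm (u *\<^sub>R a + v *\<^sub>R b) - (u *\<^sub>R a + v *\<^sub>R b) \<bullet> y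
        \<le> u * (norm a - a \<bullet> y) + v * (norm b - b \<bullet> y)"
      by (simp add: algebra_simps)
    also have "\<dots> \<le> u * p y + v * p y"
      using ab uv by (intro add_mono mult_left_mono le_p) auto
    also have "\<dots> = p y" using uv by (metis distrib_right mult_1)
    finally show "norm (u *\<^sub>R a + v *\<^sub>R b) - (u *\<^sub>R a + v *\<^sub>R b) \<bullet> y \<le> p y" .
  qed
qed

lemma convex_body_B: "convex_body B"
  using compact_B convex_B zero_interior_B unfolding convex_body_def by blast

lemma frontier_subset_B: "frontier B \<subseteq> B"
  using compact_B by (simp add: compact_imp_closed frontier_subset_eq)

text \<open>The focal expression is positively homogeneous and its maximum is positive, so moving
  outwards from a maximiser leaves \<open>B\<close>.\<close>

lemma p_attained_frontier:
  assumes "norm y = 1" "X \<in> B" "norm X - X \<bullet> y = p y"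
  shows "X \<in> frontier B"
proof -
  have "X \<notin> interior B"
  proof (rule scaleR_notin_interior)
    fix t :: real assume t: "t > 1"
    show "t *\<^sub>R X \<notin> B"
    proof
      assume "t *\<^sub>R X \<in> B"
      from le_p[OF this, of y] have "t * p y \<le> p y" using t assms(3) focal_scaleR[of t X y] by simp
      then show False using t p_pos[OF assms(1)] by simp
    qed
  qed
  then show ?thesis using assms(2) closure_subset unfolding frontier_def by blast
qed

text \<open>Containment forces the parameter to be at least the maximum \<open>p y\<close>, contact
  forces it to be at most \<open>p y\<close>. The maximum over \<open>B\<close> is reached on the
  frontier, so the frontier and \<open>B\<close> give the same value.\<close>

lemma supporting_paraboloid_iff:
  "supporting_paraboloid y q (frontier B) \<longleftrightarrow> norm y = 1 \<and> q = ennreal (p y)"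
proof (cases "norm y = 1")
  case True
  have nonneg: "0 \<le> norm X - X \<bullet> y" for X
    using norm_cauchy_schwarz[of X y] True by simp
  obtain X where X: "X \<in> B" "norm X - X \<bullet> y = p y" using p_attained by blast
  then have XF: "X \<in> frontier B" using p_attained_frontier[OF True] by blast
  have upper: "ennreal (norm Y - Y \<bullet> y) \<le> ennreal (p y)" if "Y \<in> frontier B" for Y
    using that frontier_subset_B le_p by (intro ennreal_leI) blast
  show ?thesis
  proof
    assume "supporting_paraboloid y q (frontier B)"
    then obtain Y where Y: "Y \<in> frontier B" "ennreal (norm Y - Y \<bullet> y) = q"
      and le: "\<And>W. W \<in> frontier B \<Longrightarrow> ennreal (norm W - W \<bullet> y) \<le> q"
      unfolding supporting_paraboloid_def paraboloid_def paraboloid_body_def by blast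
    have "q = ennreal (p y)" using upper[OF Y(1)] le[OF XF] X(2) Y(2) by (intro antisym) auto
    then show "norm y = 1 \<and> q = ennreal (p y)" using True by simp
  next
    assume "norm y = 1 \<and> q = ennreal (p y)"
    then have "X \<in> paraboloid y q \<inter> frontier B" "frontier B \<subseteq> paraboloid_body y q"
      using X(2) XF upper by (auto simp: paraboloid_def paraboloid_body_def)
    then show "supporting_paraboloid y q (frontier B)"
      using True unfolding supporting_paraboloid_def by auto
  qed
qed (simp add: supporting_paraboloid_def)

lemma focal_function_eq:
  assumes "norm y = 1"
  shows "focal_function (frontier B) y = p y"
  using assms p_pos[OF assms] unfolding focal_function_def supporting_paraboloid_iff by simp

lemma directrix_hyperplane_eq:
  assumes "norm y = 1"
  shows "directrix_hyperplane y (ennreal (p y)) = {Z. Z \<bullet> (- y) = p y}"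
  using p_pos[OF assms] by (simp add: directrix_hyperplane_def)

lemma support_function_eq: "support_function (frontier B) u = h u"
  by (simp add: support_function_def body_bounded_by_frontier convex_body_B h_def)

section \<open>The directrix body: compactness and convexity\<close>

definition directrix_body :: "'a set" where
  "directrix_body = (\<Union>X\<in>B. cball X (norm X))"

lemma mem_directrix_body: "Z \<in> directrix_body \<longleftrightarrow> (\<exists>X\<in>B. norm (X - Z) \<le> norm X)"
  by (simp add: directrix_body_def dist_norm)

lemma mem_directrix_body_iff_h: "Z \<in> directrix_body \<longleftrightarrow> Z \<bullet> Z \<le> 2 * h Z"
proof -
  obtain X where "X \<in> B" "X \<bullet> Z = h Z" using h_attained by blast
  then show ?thesis
    unfolding mem_directrix_body norm_diff_le_norm_iff using le_h[of _ Z]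
    by (smt (verit, best))
qed

lemma inner_le_p_of_mem_directrix_body:
  assumes "norm y = 1" "Z \<in> directrix_body"
  shows "Z \<bullet> (- y) \<le> p y"
proof -
  obtain X where X: "X \<in> B" "norm (X - Z) \<le> norm X" using assms mem_directrix_body by blast
  then show ?thesis
    using le_p[OF X(1), of y] norm_cauchy_schwarz[of "X - Z" y] assms(1)
    by (simp add: inner_diff_left)
qed

text \<open>This is the point of the ball around \<open>X\<close> farthest in direction
  \<open>- y\<close>; it is a directrix point when \<open>X\<close> lies on the supporting
  paraboloid with axis \<open>y\<close>.\<close>

lemma mem_directrix_body_of_mem_B:
  assumes "X \<in> B" "norm y = 1"
  shows "X - norm X *\<^sub>R y \<in> directrix_body"
  unfolding mem_directrix_body using assms by (intro bexI[of _ X]) auto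

lemma compact_directrix_body: "compact directrix_body"
proof -
  have "directrix_body = (\<lambda>(X, v). X + norm X *\<^sub>R v) ` (B \<times> cball 0 1)"
  proof (intro equalityI subsetI)
    fix Z assume "Z \<in> directrix_body"
    then obtain X where X: "X \<in> B" "norm (X - Z) \<le> norm X" using mem_directrix_body by blast
    show "Z \<in> (\<lambda>(X, v). X + norm X *\<^sub>R v) ` (B \<times> cball 0 1)"
    \<comment> \<open>For \<open>X = 0\<close> the inverse is 0, hence so is the second component;
      this fits because the ball then reduces to the point 0.\<close>
    proof (rule image_eqI[of _ _ "(X, inverse (norm X) *\<^sub>R (Z - X))"])
      show "(X, inverse (norm X) *\<^sub>R (Z - X)) \<in> B \<times> cball 0 1"
        using X by (auto simp: norm_minus_commute divide_simps split: if_splits)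
      show "Z = (\<lambda>(X, v). X + norm X *\<^sub>R v) (X, inverse (norm X) *\<^sub>R (Z - X))"
        using X by (cases "X = 0") auto
    qed
  next
    fix Z assume "Z \<in> (\<lambda>(X, v). X + norm X *\<^sub>R v) ` (B \<times> cball 0 1)"
    then obtain X v where X: "X \<in> B" "norm v \<le> 1" "Z = X + norm X *\<^sub>R v" by auto
    then have "norm (X - Z) \<le> norm X" by (simp add: mult_left_le)
    with X(1) show "Z \<in> directrix_body" unfolding mem_directrix_body by blast
  qed
  moreover have "compact ((\<lambda>(X, v). X + norm X *\<^sub>R v) ` (B \<times> cball 0 1))"
    unfolding case_prod_beta
    by (intro compact_continuous_image compact_Times compact_B compact_cball continuous_intros)
  ultimately show ?thesis by simp
qed

text \<open>A ball containing \<open>0\<close> and \<open>Z\<close> is shrunk by a homothety centred at \<open>Z\<close> until \<open>0\<close> lies on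
  its boundary.\<close>

lemma mem_directrix_body_of_ball:
  assumes sub: "\<And>y. norm y = 1 \<Longrightarrow> r - C \<bullet> y \<le> p y"
    and zero: "norm C \<le> r" and Z: "norm (C - Z) \<le> r"
    and supp: "\<And>y. norm y = 1 \<Longrightarrow> Z \<bullet> (- y) \<le> p y"
  shows "Z \<in> directrix_body"
proof -
  have r: "r \<ge> 0" using zero norm_ge_zero order_trans by blast
  \<comment> \<open>Radius minus distance of the centre from 0, for the ball shrunk by the factor
    \<open>s\<close> towards \<open>Z\<close>. A zero of \<open>g\<close> is a ball with 0 on its
    boundary.\<close>
  define g where "g s = s * r - norm (Z + s *\<^sub>R (C - Z))" for s :: real
  have "continuous_on {0..1} g" unfolding g_def by (intro continuous_intros)
  moreover have "g 0 \<le> 0" "0 \<le> g 1" using zero by (simp_all add: g_def)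
  ultimately obtain s where s: "0 \<le> s" "s \<le> 1" "g s = 0"
    using IVT'[of g 0 0 1] by auto
  define X where "X = Z + s *\<^sub>R (C - Z)"
  have nX: "norm X = s * r" using s by (simp add: g_def X_def)
  have "X \<in> B"
  proof (rule mem_BI)
    fix y :: 'a assume y: "norm y = 1"
    \<comment> \<open>The support value of the shrunk ball interpolates between those of the
      original ball and of the point \<open>Z\<close>, both at most \<open>p y\<close>.\<close>
    have "norm X - X \<bullet> y = s * (r - C \<bullet> y) + (1 - s) * (Z \<bullet> (- y))"
      unfolding nX by (simp add: X_def algebra_simps)
    also have "\<dots> \<le> s * p y + (1 - s) * p y"
      using s sub[OF y] supp[OF y] by (intro add_mono mult_left_mono) auto
    finally show "norm X - X \<bullet> y \<le> p y" by (simp add: algebra_simps)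
  qed
  moreover have "norm (X - Z) \<le> norm X"
    unfolding nX using s Z by (simp add: X_def mult_left_mono)
  ultimately show ?thesis using mem_directrix_body by blast
qed

text \<open>A convex combination of two balls of the union is a ball that contains 0, in general not
  on its boundary. It still respects the bounds \<open>p\<close>, so
  \<open>mem_directrix_body_of_ball\<close> applies to it.\<close>

lemma convex_directrix_body: "convex directrix_body"
proof (rule convexI)
  fix u v :: real and a b :: 'a
  assume ab: "a \<in> directrix_body" "b \<in> directrix_body" and uv: "0 \<le> u" "0 \<le> v" "u + v = 1"
  obtain X Y where X: "X \<in> B" "norm (X - a) \<le> norm X" and Y: "Y \<in> B" "norm (Y - b) \<le> norm Y"
    using ab mem_directrix_body by meson
  have comb: "u * s + v * t \<le> w" if "s \<le> w" "t \<le> w" for s t w :: real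
  proof -
    have "u * s + v * t \<le> u * w + v * w" using that uv by (intro add_mono mult_left_mono) auto
    then show ?thesis using uv by (metis distrib_right mult_1)
  qed
  show "u *\<^sub>R a + v *\<^sub>R b \<in> directrix_body"
  proof (rule mem_directrix_body_of_ball[where r = "u * norm X + v * norm Y" and C = "u *\<^sub>R X + v *\<^sub>R Y"])
    fix y :: 'a assume y: "norm y = 1"
    show "u * norm X + v * norm Y - (u *\<^sub>R X + v *\<^sub>R Y) \<bullet> y \<le> p y"
      using comb[OF le_p[OF X(1), of y] le_p[OF Y(1), of y]]
      by (simp add: algebra_simps)
    show "(u *\<^sub>R a + v *\<^sub>R b) \<bullet> (- y) \<le> p y"
      using comb[OF inner_le_p_of_mem_directrix_body[OF y ab(1)] inner_le_p_of_mem_directrix_body[OF y ab(2)]]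
      by (simp add: algebra_simps)
  next
    show "norm (u *\<^sub>R X + v *\<^sub>R Y) \<le> u * norm X + v * norm Y"
      using norm_triangle_ineq[of "u *\<^sub>R X" "v *\<^sub>R Y"] uv by simp
    have "u *\<^sub>R X + v *\<^sub>R Y - (u *\<^sub>R a + v *\<^sub>R b) = u *\<^sub>R (X - a) + v *\<^sub>R (Y - b)"
      by (simp add: algebra_simps)
    then have "norm (u *\<^sub>R X + v *\<^sub>R Y - (u *\<^sub>R a + v *\<^sub>R b)) \<le> u * norm (X - a) + v * norm (Y - b)"
      using norm_triangle_ineq[of "u *\<^sub>R (X - a)" "v *\<^sub>R (Y - b)"] uv by simp
    also have "\<dots> \<le> u * norm X + v * norm Y"
      using X Y uv by (intro add_mono mult_left_mono) auto
    finally show "norm (u *\<^sub>R X + v *\<^sub>R Y - (u *\<^sub>R a + v *\<^sub>R b)) \<le> u * norm X + v * norm Y" .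
  qed
qed

text \<open>Near 0 the quadratic \<open>Z \<bullet> Z\<close> stays below the linear lower bound for
  \<open>h\<close>.\<close>

lemma zero_interior_directrix_body: "0 \<in> interior directrix_body"
proof -
  obtain e where e: "e > 0" "\<And>u. e * norm u \<le> h u" using h_lower by blast
  have "Z \<in> directrix_body" if "Z \<in> ball 0 e" for Z
  proof -
    have "Z \<bullet> Z \<le> e * norm Z" using that
      by (simp add: dot_square_norm power2_eq_square mult_right_mono)
    also have "\<dots> \<le> h Z" by (rule e)
    moreover have "h Z \<ge> 0" using e(1) e(2)[of Z] by (smt (verit) mult_nonneg_nonneg norm_ge_zero)
    ultimately show ?thesis unfolding mem_directrix_body_iff_h by simp
  qed
  then show ?thesis unfolding mem_interior using e(1) by blast
qed

lemma convex_body_directrix_body: "convex_body directrix_body"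
  using compact_directrix_body convex_directrix_body zero_interior_directrix_body unfolding convex_body_def by blast

section \<open>Radial description of the boundary and contact with paraboloids\<close>

lemma frontier_directrix_body: "frontier directrix_body = (\<lambda>u. (2 * h u) *\<^sub>R u) ` sphere 0 1"
proof (intro equalityI subsetI)
  fix Z assume Z: "Z \<in> frontier directrix_body"
  then have Z0: "Z \<noteq> 0" using zero_interior_directrix_body by (auto simp: frontier_def)
  have "Z \<in> directrix_body" using Z compact_directrix_body compact_imp_closed frontier_subset_eq by blast
  moreover have "\<not> Z \<bullet> Z < 2 * h Z"
  proof
    assume less: "Z \<bullet> Z < 2 * h Z"
    \<comment> \<open>Strict inequality is an open condition, so at a boundary point the inequality
      defining the body is an equality.\<close>
    have "open {Z. Z \<bullet> Z < 2 * h Z}"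
      by (intro open_Collect_less continuous_intros continuous_on_h)
    moreover have "{Z. Z \<bullet> Z < 2 * h Z} \<subseteq> directrix_body" by (auto simp: mem_directrix_body_iff_h)
    ultimately have "Z \<in> interior directrix_body" using less interior_maximal by blast
    then show False using Z by (simp add: frontier_def)
  qed
  ultimately have "Z \<bullet> Z = 2 * h Z" unfolding mem_directrix_body_iff_h by simp
  moreover have "h Z = norm Z * h (sgn Z)"
    using h_scaleR[of "norm Z" "sgn Z"] Z0 by (simp add: sgn_div_norm)
  ultimately have "norm Z = 2 * h (sgn Z)"
    using Z0 by (simp add: dot_square_norm power2_eq_square)
  then have "Z = (2 * h (sgn Z)) *\<^sub>R sgn Z"
    using Z0 by (metis norm_eq_zero divideR_right sgn_div_norm)
  moreover have "sgn Z \<in> sphere 0 1" using Z0 by (simp add: norm_sgn)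
  ultimately show "Z \<in> (\<lambda>u. (2 * h u) *\<^sub>R u) ` sphere 0 1" by blast
next
  fix Z assume "Z \<in> (\<lambda>u. (2 * h u) *\<^sub>R u) ` sphere 0 1"
  then obtain u where u: "norm u = 1" "Z = (2 * h u) *\<^sub>R u" by auto
  have hu: "h u > 0" using h_pos_unit u(1) by simp
  \<comment> \<open>On a ray the left side of the inequality grows quadratically and
    \<open>h\<close> linearly, so cancelling one factor \<open>c\<close> leaves a bound on the
    length.\<close>
  have iff: "t *\<^sub>R Z \<in> directrix_body \<longleftrightarrow> t \<le> 1" if "t > 0" for t
  proof -
    define c where "c = t * (2 * h u)"
    have c: "c > 0" "t *\<^sub>R Z = c *\<^sub>R u" using that hu u by (simp_all add: c_def)
    have "(c *\<^sub>R u) \<bullet> (c *\<^sub>R u) = c * c" using u by (simp add: dot_square_norm power2_eq_square)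
    then have "t *\<^sub>R Z \<in> directrix_body \<longleftrightarrow> c * c \<le> c * (2 * h u)"
      unfolding c(2) mem_directrix_body_iff_h using h_scaleR[of c u] c(1) by (simp add: mult.left_commute)
    also have "\<dots> \<longleftrightarrow> t * (2 * h u) \<le> 1 * (2 * h u)"
      unfolding mult_le_cancel_left_pos[OF c(1)] by (simp add: c_def)
    also have "\<dots> \<longleftrightarrow> t \<le> 1" using hu by (intro mult_le_cancel_right_pos) simp
    finally show ?thesis .
  qed
  have "Z \<notin> interior directrix_body" by (rule scaleR_notin_interior) (simp add: iff)
  moreover have "Z \<in> directrix_body" using iff[of 1] by simp
  ultimately show "Z \<in> frontier directrix_body" using closure_subset unfolding frontier_def by blast
qed

text \<open>A hyperplane supporting the directrix body at \<open>(2 * h u) *\<^sub>R u\<close>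
  yields the axis \<open>y\<close>. The ball around \<open>X\<close> contains that point, and
  equality in Cauchy-Schwarz makes it the farthest point of the ball in direction
  \<open>- y\<close>.\<close>

lemma supporting_axis_at:
  assumes u: "norm u = 1" and X: "X \<in> B" "X \<bullet> u = h u"
  obtains y where "norm y = 1" "norm X - X \<bullet> y = p y" "X - norm X *\<^sub>R y = (2 * h u) *\<^sub>R u"
proof -
  define Z where "Z = (2 * h u) *\<^sub>R u"
  have ZF: "Z \<in> frontier directrix_body" using u by (simp add: frontier_directrix_body Z_def)
  then have ZK: "Z \<in> directrix_body" using compact_directrix_body compact_imp_closed frontier_subset_eq by blast
  have "Z \<notin> interior directrix_body" using ZF by (simp add: frontier_def)
  then have "Z \<notin> rel_interior directrix_body"
    using zero_interior_directrix_body rel_interior_nonempty_interior by blast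
  then obtain a where a: "a \<noteq> 0" "\<And>W. W \<in> directrix_body \<Longrightarrow> a \<bullet> Z \<le> a \<bullet> W"
    using supporting_hyperplane_rel_boundary[OF convex_directrix_body ZK] by metis
  \<comment> \<open>The normal \<open>a\<close> points into the body, so \<open>- y\<close> is the
    outward normal.\<close>
  define y where "y = sgn a"
  have y: "norm y = 1" "\<And>W. W \<in> directrix_body \<Longrightarrow> y \<bullet> Z \<le> y \<bullet> W"
    using a by (auto simp: y_def norm_sgn sgn_div_norm divide_right_mono)
  obtain W where W: "W \<in> B" "norm W - W \<bullet> y = p y" using p_attained by blast
  \<comment> \<open>The comparison point reaches the value \<open>p y\<close> in direction
    \<open>- y\<close>, so \<open>Z\<close> must reach it too.\<close>
  have "y \<bullet> Z \<le> y \<bullet> (W - norm W *\<^sub>R y)"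
    using y(2) mem_directrix_body_of_mem_B[OF W(1) y(1)] by blast
  then have pZ: "Z \<bullet> (- y) = p y"
    using inner_le_p_of_mem_directrix_body[OF y(1) ZK] W(2) y(1)
    by (simp add: inner_diff_right inner_commute dot_square_norm)
  have "Z \<bullet> Z = 2 * (X \<bullet> Z)" using u X by (simp add: Z_def dot_square_norm power2_eq_square)
  then have "norm (X - Z) \<le> norm X" by (simp add: norm_diff_le_norm_iff)
  moreover have "norm X \<le> (X - Z) \<bullet> y"
    using le_p[OF X(1), of y] pZ by (simp add: inner_diff_left)
  moreover have "(X - Z) \<bullet> y \<le> norm (X - Z)"
    using norm_cauchy_schwarz[of "X - Z" y] y(1) by simp
  \<comment> \<open>The three estimates form a cycle from \<open>norm X\<close> through
    \<open>(X - Z) \<bullet> y\<close> and \<open>norm (X - Z)\<close> back to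
    \<open>norm X\<close>.\<close>
  ultimately have eq: "norm (X - Z) = norm X" "(X - Z) \<bullet> y = norm X" by auto
  then have "X - Z = norm X *\<^sub>R y" using norm_le_inner_unitD[OF y(1), of "X - Z"] by simp
  then have "X - norm X *\<^sub>R y = Z" by (simp add: algebra_simps)
  moreover have "norm X - X \<bullet> y = p y" using eq(2) pZ by (simp add: inner_diff_left)
  ultimately show thesis using that y(1) Z_def by blast
qed

section \<open>Identification of the directrix with the boundary\<close>

text \<open>Beyond \<open>X\<close> on its ray the focal expression exceeds \<open>p y\<close>, so
  \<open>X\<close> is the last point of the ray in \<open>B\<close>.\<close>

lemma radial_point_frontier:
  assumes "X \<in> B" "norm y = 1" "norm X - X \<bullet> y = p y"
  shows "radial_function (frontier B) (sgn X) = norm X"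
    "radial_point (frontier B) (sgn X) = X" "sgn X \<in> sphere 0 1"
proof -
  have X0: "X \<noteq> 0" using assms p_pos[OF assms(2)] by auto
  show "sgn X \<in> sphere 0 1" using X0 by (simp add: norm_sgn)
  have "Sup {t. 0 \<le> t \<and> t *\<^sub>R sgn X \<in> B} = norm X"
  proof (rule cSup_eq_maximum)
    show "norm X \<in> {t. 0 \<le> t \<and> t *\<^sub>R sgn X \<in> B}"
      using assms(1) X0 by (simp add: sgn_div_norm)
    fix t assume "t \<in> {t. 0 \<le> t \<and> t *\<^sub>R sgn X \<in> B}"
    then have t: "0 \<le> t" "t *\<^sub>R sgn X \<in> B" by auto
    have "norm (t *\<^sub>R sgn X) - (t *\<^sub>R sgn X) \<bullet> y = t / norm X * p y"
      using t(1) assms(3) focal_scaleR[of "t / norm X" X y] by (simp add: sgn_div_norm divide_inverse)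
    then have "t / norm X * p y \<le> 1 * p y" using le_p[OF t(2), of y] by simp
    then have "t / norm X \<le> 1" using p_pos[OF assms(2)] by (simp only: mult_le_cancel_right_pos)
    then show "t \<le> norm X" using X0 by simp
  qed
  then show "radial_function (frontier B) (sgn X) = norm X"
    by (simp add: radial_function_def body_bounded_by_frontier convex_body_B)
  then show "radial_point (frontier B) (sgn X) = X"
    using X0 by (simp add: radial_point_def sgn_div_norm)
qed

lemma radial_function_nonneg:
  assumes "norm x = 1"
  shows "0 \<le> radial_function (frontier B) x"
  unfolding radial_function_def body_bounded_by_frontier[OF convex_body_B]
proof (rule cSup_upper)
  show "0 \<in> {t. 0 \<le> t \<and> t *\<^sub>R x \<in> B}" using zero_interior_B interior_subset by auto
  obtain M where "\<And>X. X \<in> B \<Longrightarrow> norm X \<le> M"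
    using compact_imp_bounded[OF compact_B] bounded_pos by blast
  then show "bdd_above {t. 0 \<le> t \<and> t *\<^sub>R x \<in> B}"
    using assms by (intro bdd_aboveI[of _ M]) force
qed

text \<open>This eliminates the direction \<open>x\<close>: it is recovered as \<open>sgn X\<close>,
  and the radial function there is \<open>norm X\<close>.\<close>

lemma directrix_eq:
  "directrix (frontier B) = {X - norm X *\<^sub>R y |X y. X \<in> B \<and> norm y = 1 \<and> norm X - X \<bullet> y = p y}"
  (is "_ = ?D")
proof (intro equalityI subsetI)
  fix Z assume "Z \<in> directrix (frontier B)"
  then obtain x y q where x: "norm x = 1"
    and y: "supporting_paraboloid_at y q (frontier B) (radial_point (frontier B) x)"
    and Z: "Z = radial_point (frontier B) x - radial_function (frontier B) x *\<^sub>R y"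
    unfolding directrix_def directrix_at_def reflector_map_def by auto
  define X where "X = radial_point (frontier B) x"
  have "norm X = radial_function (frontier B) x"
    using radial_function_nonneg[OF x] x by (simp add: X_def radial_point_def)
  then have "Z = X - norm X *\<^sub>R y" using Z X_def by simp
  moreover have "norm y = 1" "q = ennreal (p y)"
    using y by (auto simp: supporting_paraboloid_at_def supporting_paraboloid_iff)
  moreover have "X \<in> B" "ennreal (norm X - X \<bullet> y) = q"
    using y frontier_subset_B
    by (auto simp: supporting_paraboloid_at_def paraboloid_def X_def)
  \<comment> \<open>Nonnegativity allows the equality in \<open>ennreal\<close> to be read as one of
    reals.\<close>
  moreover have "norm X - X \<bullet> y \<ge> 0"
    using norm_cauchy_schwarz[of X y] \<open>norm y = 1\<close> by simp
  ultimately show "Z \<in> ?D" using p_pos[of y] ennreal_inj by auto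
next
  fix Z assume "Z \<in> ?D"
  then obtain X y where X: "X \<in> B" "norm y = 1" "norm X - X \<bullet> y = p y"
    and Z: "Z = X - norm X *\<^sub>R y" by blast
  note rad = radial_point_frontier[OF X]
  have "supporting_paraboloid_at y (ennreal (p y)) (frontier B) X"
    using X p_attained_frontier[OF X(2,1,3)]
    by (simp add: supporting_paraboloid_at_def supporting_paraboloid_iff paraboloid_def)
  then have "y \<in> reflector_map (frontier B) (sgn X)"
    using X rad by (auto simp: reflector_map_def)
  then have "Z \<in> directrix_at (frontier B) (sgn X)"
    using Z rad by (auto simp: directrix_at_def)
  then show "Z \<in> directrix (frontier B)" using rad(3) by (auto simp: directrix_def)
qed

text \<open>A directrix point attains \<open>p y\<close> in direction \<open>- y\<close>, so its
  larger multiples violate that bound. Conversely, a boundary point comes from a maximiser of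
  \<open>X \<bullet> u\<close> through \<open>supporting_axis_at\<close>.\<close>

lemma directrix_eq_frontier_directrix_body: "directrix (frontier B) = frontier directrix_body"
proof (intro equalityI subsetI)
  fix Z assume "Z \<in> directrix (frontier B)"
  then obtain X y where X: "X \<in> B" "norm y = 1" "norm X - X \<bullet> y = p y"
    and Z: "Z = X - norm X *\<^sub>R y" unfolding directrix_eq by blast
  have "Z \<in> directrix_body" using X Z mem_directrix_body_of_mem_B by blast
  moreover have "Z \<notin> interior directrix_body"
  proof (rule scaleR_notin_interior, rule notI)
    fix t :: real assume t: "t > 1" and tZ: "t *\<^sub>R Z \<in> directrix_body"
    have "Z \<bullet> (- y) = p y" using X Z by (simp add: inner_diff_left dot_square_norm)
    then have "(t *\<^sub>R Z) \<bullet> (- y) = t * p y" by (metis inner_scaleR_left)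
    then have "t * p y \<le> p y" using inner_le_p_of_mem_directrix_body[OF X(2) tZ] by simp
    then show False using t p_pos[OF X(2)] by simp
  qed
  ultimately show "Z \<in> frontier directrix_body" using closure_subset unfolding frontier_def by blast
next
  fix Z assume "Z \<in> frontier directrix_body"
  then obtain u where u: "norm u = 1" "Z = (2 * h u) *\<^sub>R u" by (auto simp: frontier_directrix_body)
  obtain X where X: "X \<in> B" "X \<bullet> u = h u" using h_attained by blast
  obtain y where "norm y = 1" "norm X - X \<bullet> y = p y" "X - norm X *\<^sub>R y = (2 * h u) *\<^sub>R u"
    using supporting_axis_at[OF u(1) X] by blast
  then show "Z \<in> directrix (frontier B)" using X(1) u(2) unfolding directrix_eq by force
qed

section \<open>Supporting hyperplanes and support function of the directrix\<close>

lemma p_attained_directrix: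
  assumes "norm y = 1"
  obtains Z where "Z \<in> frontier directrix_body" "Z \<bullet> (- y) = p y"
proof -
  obtain X where X: "X \<in> B" "norm X - X \<bullet> y = p y" using p_attained by blast
  then have "X - norm X *\<^sub>R y \<in> frontier directrix_body"
    using assms unfolding directrix_eq_frontier_directrix_body[symmetric] directrix_eq by blast
  moreover have "(X - norm X *\<^sub>R y) \<bullet> (- y) = p y"
    using X assms by (simp add: inner_diff_left dot_square_norm)
  ultimately show thesis using that by blast
qed

lemma frontier_directrix_body_subset: "frontier directrix_body \<subseteq> directrix_body"
  using compact_directrix_body by (simp add: compact_imp_closed frontier_subset_eq)

lemma supporting_hyperplane_directrix_iff:
  "supporting_hyperplane (frontier directrix_body) H u \<longleftrightarrow> norm u = 1 \<and> H = {Z. Z \<bullet> u = p (- u)}"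
proof (cases "norm u = 1")
  case True
  obtain Z where Z: "Z \<in> frontier directrix_body" "Z \<bullet> u = p (- u)"
    using p_attained_directrix[of "- u"] True by auto
  have "W \<bullet> u \<le> p (- u)" if "W \<in> frontier directrix_body" for W
    using inner_le_p_of_mem_directrix_body[of "- u" W] that frontier_directrix_body_subset True by auto
  note le = this
  show ?thesis
  proof
    assume "supporting_hyperplane (frontier directrix_body) H u"
    then obtain c W where H: "H = {Z. Z \<bullet> u = c}" "frontier directrix_body \<subseteq> {Z. Z \<bullet> u \<le> c}"
      and W: "W \<in> frontier directrix_body" "W \<bullet> u = c"
      unfolding supporting_hyperplane_def by blast
    have "c = p (- u)" using H(2) W Z le[OF W(1)] by (intro antisym) auto
    then show "norm u = 1 \<and> H = {Z. Z \<bullet> u = p (- u)}" using True H(1) by simp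
  next
    assume "norm u = 1 \<and> H = {Z. Z \<bullet> u = p (- u)}"
    then show "supporting_hyperplane (frontier directrix_body) H u"
      unfolding supporting_hyperplane_def
      using Z le by (intro conjI exI[of _ "p (- u)"]) auto
  qed
qed (simp add: supporting_hyperplane_def)

lemma support_function_directrix:
  assumes "norm y = 1"
  shows "support_function (frontier directrix_body) (- y) = p y"
proof -
  obtain Z where "Z \<in> frontier directrix_body" "Z \<bullet> (- y) = p y"
    using p_attained_directrix[OF assms] .
  then have "(SUP Z\<in>directrix_body. Z \<bullet> (- y)) = p y"
    using inner_le_p_of_mem_directrix_body[OF assms] frontier_directrix_body_subset
    by (intro cSup_eq_maximum) force+
  then show ?thesis
    by (simp add: support_function_def body_bounded_by_frontier convex_body_directrix_body)
qed

section \<open>Smoothness of the radial parametrization\<close>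

lemma inj_on_parametrization: "inj_on (\<lambda>u. (2 * h u) *\<^sub>R u) (sphere 0 1)"
proof (rule inj_onI)
  fix u v :: 'a
  assume u: "u \<in> sphere 0 1" and v: "v \<in> sphere 0 1" and eq: "(2 * h u) *\<^sub>R u = (2 * h v) *\<^sub>R v"
  have pos: "h u > 0" "h v > 0" using h_pos_unit u v by simp_all
  have "norm ((2 * h u) *\<^sub>R u) = norm ((2 * h v) *\<^sub>R v)" using eq by simp
  then have "h u = h v" using pos u v by simp
  then show "u = v" using eq pos by simp
qed

text \<open>The paraboloids are strictly convex because the norm is affine on a segment only if the
  segment lies on a ray from the origin.\<close>

lemma h_attained_unique:
  assumes u: "u \<noteq> 0" and X: "X \<in> B" "X \<bullet> u = h u" and Y: "Y \<in> B" "Y \<bullet> u = h u"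
  shows "X = Y"
proof -
  define w where "w = sgn u"
  have w: "norm w = 1" using u by (simp add: w_def norm_sgn)
  have hw: "h w = h u / norm u"
    using h_scaleR[of "inverse (norm u)" u] by (simp add: w_def sgn_div_norm divide_inverse_commute)
  have Xw: "X \<bullet> w = h w" and Yw: "Y \<bullet> w = h w"
    unfolding hw using X Y by (simp_all add: w_def sgn_div_norm field_simps)
  have hpos: "h w > 0" using h_pos_unit w by simp
  define M where "M = (1/2) *\<^sub>R X + (1/2) *\<^sub>R Y"
  have "M \<in> B" unfolding M_def using convex_B X Y by (intro convexD) auto
  moreover have "M \<bullet> w = h w" by (simp add: M_def inner_add_left Xw Yw)
  ultimately obtain y where y: "norm y = 1" "norm M - M \<bullet> y = p y"
    using supporting_axis_at[OF w] by metis
  \<comment> \<open>The midpoint lies on the paraboloid with axis \<open>y\<close> while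
    \<open>X\<close> and \<open>Y\<close> lie in its body; on adding, the inner products with
    \<open>y\<close> cancel.\<close>
  have "norm X + norm Y \<le> 2 * norm M"
    using le_p[OF X(1), of y] le_p[OF Y(1), of y] y(2) by (simp add: M_def inner_add_left)
  also have "2 * norm M = norm (2 *\<^sub>R M)" by simp
  also have "2 *\<^sub>R M = X + Y" by (simp add: M_def algebra_simps)
  finally have "norm (X + Y) = norm X + norm Y" using norm_triangle_ineq[of X Y] by simp
  then have eq: "norm X *\<^sub>R Y = norm Y *\<^sub>R X" using norm_triangle_eq by blast
  \<comment> \<open>Pairing with \<open>w\<close> compares the lengths, since both points have the
    same positive inner product with it.\<close>
  then have "norm X * h w = norm Y * h w" by (metis Xw Yw inner_scaleR_left)
  then have "norm X = norm Y" using hpos by simp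
  moreover have "X \<noteq> 0" using Xw hpos by auto
  ultimately show "X = Y" using eq by (metis norm_eq_zero scaleR_left_imp_eq)
qed

text \<open>The future gradient of \<open>h\<close>. For nonzero \<open>u\<close> only one point
  qualifies; at 0 every point of \<open>B\<close> does, hence the restriction to
  \<open>- {0}\<close> below.\<close>

definition contact_point :: "'a \<Rightarrow> 'a" where
  "contact_point u = (SOME X. X \<in> B \<and> X \<bullet> u = h u)"

lemma contact_point: "contact_point u \<in> B" "contact_point u \<bullet> u = h u"
  unfolding contact_point_def using someI_ex[of "\<lambda>X. X \<in> B \<and> X \<bullet> u = h u"] h_attained by blast+

text \<open>By uniqueness the graph is cut out by a closed condition, and a closed graph with values
  in a compact set gives continuity.\<close>

lemma continuous_on_contact_point: "continuous_on (- {0}) contact_point"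
proof -
  have "(\<lambda>u. (u, contact_point u)) ` (- {0}) = (- {0}) \<times> B \<inter> {z. snd z \<bullet> fst z = h (fst z)}"
    using contact_point h_attained_unique by (auto simp: image_iff)
  moreover have "closed {z. snd z \<bullet> fst z = h (fst z)}"
    by (intro closed_Collect_eq continuous_intros continuous_on_compose2[OF continuous_on_h]) auto
  ultimately have "closedin (top_of_set ((- {0}) \<times> B)) ((\<lambda>u. (u, contact_point u)) ` (- {0}))"
    by (simp add: closedin_closed_Int)
  then show ?thesis
    using continuous_closed_graph_eq[OF compact_B, of contact_point "- {0}"] contact_point by blast
qed

text \<open>Testing each contact point against the other direction traps the error between 0 and
  \<open>(contact_point v - contact_point u) \<bullet> (v - u)\<close>, which is small by
  continuity.\<close>

lemma has_derivative_h:
  assumes "u \<noteq> 0"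
  shows "(h has_derivative (\<lambda>v. contact_point u \<bullet> v)) (at u)"
proof (rule has_derivativeI_sandwich[where e = 1 and H = "\<lambda>v. norm (contact_point v - contact_point u)"])
  show "bounded_linear (\<lambda>v. contact_point u \<bullet> v)" by (rule bounded_linear_inner_right)
  have "isCont contact_point u"
    using continuous_on_contact_point assms by (simp add: continuous_on_eq_continuous_at open_Compl)
  then show "((\<lambda>v. norm (contact_point v - contact_point u)) \<longlongrightarrow> 0) (at u)"
    using LIM_zero tendsto_norm_zero isCont_def by blast
  fix v assume v: "v \<noteq> u"
  have "contact_point v \<bullet> u \<le> h u" "contact_point u \<bullet> v \<le> h v" using contact_point le_h by blast+
  then have "0 \<le> h v - h u - contact_point u \<bullet> (v - u)"
    "h v - h u - contact_point u \<bullet> (v - u) \<le> (contact_point v - contact_point u) \<bullet> (v - u)"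
    using contact_point(2)[of u] contact_point(2)[of v] by (simp_all add: inner_diff)
  moreover have "(contact_point v - contact_point u) \<bullet> (v - u)
      \<le> norm (contact_point v - contact_point u) * norm (v - u)"
    by (rule norm_cauchy_schwarz)
  ultimately show "norm (h v - h u - contact_point u \<bullet> (v - u)) / norm (v - u)
      \<le> norm (contact_point v - contact_point u)"
    using v by (simp add: divide_le_eq)
qed simp

lemma C1_immersion_parametrization: "C1_immersion_of_sphere (\<lambda>u. (2 * h u) *\<^sub>R u)"
proof -
  define F' where "F' u = 2 *\<^sub>R (blinfun_scaleR_left u o\<^sub>L blinfun_inner_left (contact_point u))
    + (2 * h u) *\<^sub>R id_blinfun" for u
  have F': "blinfun_apply (F' u) v = (2 * (contact_point u \<bullet> v)) *\<^sub>R u + (2 * h u) *\<^sub>R v" for u v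
    by (simp add: F'_def plus_blinfun.rep_eq scaleR_blinfun.rep_eq inner_commute)
  have "((\<lambda>u. (2 * h u) *\<^sub>R u) has_derivative blinfun_apply (F' u)) (at u)" if "u \<noteq> 0" for u
    by (rule has_derivative_eq_rhs, (rule derivative_intros has_derivative_h that)+)
      (auto simp: F' fun_eq_iff)
  moreover have "continuous_on (- {0}) F'"
    unfolding F'_def
    by (intro continuous_intros continuous_on_contact_point continuous_on_subset[OF continuous_on_h]
        bounded_linear.continuous_on[OF bounded_linear_blinfun_scaleR_left]
        bounded_linear.continuous_on[OF bounded_linear_blinfun_inner_left]) auto
  moreover have "inj_on (blinfun_apply (F' u)) {v. v \<bullet> u = 0}" if u: "norm u = 1" for u
  proof (rule inj_onI)
    fix v w assume vw: "v \<in> {v. v \<bullet> u = 0}" "w \<in> {v. v \<bullet> u = 0}"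
      and eq: "blinfun_apply (F' u) v = blinfun_apply (F' u) w"
    define d where "d = v - w"
    have d: "u \<bullet> d = 0" using vw by (simp add: d_def inner_diff_right inner_commute)
    have "blinfun_apply (F' u) d = 0"
      unfolding d_def blinfun.diff_right by (simp add: eq)
    \<comment> \<open>Pairing with the tangent vector \<open>d\<close> kills the radial term and
      leaves a positive multiple of \<open>d \<bullet> d\<close>.\<close>
    then have "((2 * (contact_point u \<bullet> d)) *\<^sub>R u + (2 * h u) *\<^sub>R d) \<bullet> d = 0" by (simp add: F')
    then have "h u * (d \<bullet> d) = 0" using d by (simp add: inner_add_left)
    moreover have "h u > 0" using h_pos_unit u by simp
    ultimately show "v = w" by (simp add: d_def)
  qed
  ultimately show ?thesis
    unfolding C1_immersion_of_sphere_def
    by (intro exI[of _ "- {0}"] exI[of _ "\<lambda>u. (2 * h u) *\<^sub>R u"] exI[of _ F']) auto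
qed

end

section \<open>From nondegenerate reflectors to the locale, and the theorem\<close>

lemma nondegenerate_reflector_body:
  fixes R :: "'a::euclidean_space set"
  assumes "DIM('a) \<ge> 2" "R \<in> nondegenerate_reflectors"
  obtains B where "R = frontier B" "reflector_body B"
proof -
  obtain q :: "'a \<Rightarrow> ennreal" where q: "compact (\<Inter>y\<in>sphere 0 1. paraboloid_body y (q y))"
    "interior (\<Inter>y\<in>sphere 0 1. paraboloid_body y (q y)) \<noteq> {}"
    "R = frontier (\<Inter>y\<in>sphere 0 1. paraboloid_body y (q y))"
    using assms(2) unfolding nondegenerate_reflectors_def by blast
  define B where "B = (\<Inter>y\<in>sphere 0 1. paraboloid_body y (q y))"
  define p where "p y = (SUP X\<in>B. norm X - X \<bullet> y)" for y
  have B: "compact B" "interior B \<noteq> {}" "B \<noteq> {}"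
    using q interior_subset unfolding B_def by auto
  have cont: "continuous_on B (\<lambda>X. norm X - X \<bullet> y)" for y by (intro continuous_intros)
  have p_att: "\<exists>X\<in>B. norm X - X \<bullet> y = p y" and le_p: "\<And>X. X \<in> B \<Longrightarrow> norm X - X \<bullet> y \<le> p y" for y
    using compact_SUP_attained[OF B(1,3) cont[of y]] unfolding p_def by metis+
  have mem: "X \<in> B" if X: "\<And>y. norm y = 1 \<Longrightarrow> norm X - X \<bullet> y \<le> p y" for X
    unfolding B_def paraboloid_body_def
  proof safe
    fix y :: 'a assume "y \<in> sphere 0 1"
    then have y: "norm y = 1" by simp
    obtain W where "W \<in> B" "norm W - W \<bullet> y = p y" using p_att by blast
    \<comment> \<open>The maximiser lies in every body of the family, so replacing \<open>q\<close>
      by \<open>p\<close> does not enlarge the intersection.\<close>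
    then have "ennreal (p y) \<le> q y" using y by (force simp: B_def paraboloid_body_def)
    then show "ennreal (norm X - X \<bullet> y) \<le> q y" using X[OF y] ennreal_leI order_trans by blast
  qed
  have p_pos: "p y > 0" if y: "norm y = 1" for y
  proof (rule ccontr)
    assume "\<not> p y > 0"
    then have "norm X \<le> X \<bullet> y" if "X \<in> B" for X using le_p[OF that, of y] by simp
    then show False using interior_ray_empty[OF assms(1) y] B(2) by blast
  qed
  have "continuous_on UNIV (\<lambda>u. SUP X\<in>B. norm X + X \<bullet> u)"
    by (intro continuous_on_SUP_affine B continuous_intros)
  then have "continuous_on (sphere 0 1) (\<lambda>y. SUP X\<in>B. norm X + X \<bullet> (- y))"
    by (rule continuous_on_compose2) (intro continuous_intros, simp)
  then have "continuous_on (sphere 0 1) p" by (simp add: p_def[abs_def])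
  then obtain y0 where y0: "norm y0 = 1" "\<And>y. norm y = 1 \<Longrightarrow> p y0 \<le> p y"
    using continuous_attains_inf[of "sphere (0::'a) 1" p] by auto
  \<comment> \<open>The focal expression is at most \<open>2 * norm X\<close>, which explains the
    half; \<open>p y0\<close> is the positive minimum of \<open>p\<close> over the sphere.\<close>
  have "ball 0 (p y0 / 2) \<subseteq> B"
  proof
    fix X :: 'a assume X: "X \<in> ball 0 (p y0 / 2)"
    show "X \<in> B"
    proof (rule mem)
      fix y :: 'a assume y: "norm y = 1"
      then have "norm X - X \<bullet> y \<le> 2 * norm X"
        using norm_cauchy_schwarz[of X "- y"] by simp
      then show "norm X - X \<bullet> y \<le> p y" using X y0(2)[OF y] by simp
    qed
  qed
  then have "0 \<in> interior B" using p_pos[OF y0(1)] unfolding mem_interior by (metis half_gt_zero)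
  then have "reflector_body B"
    using B(1) mem unfolding reflector_body_def p_def by blast
  then show thesis using that q(3) B_def by blast
qed

theorem theorem14:
  fixes R :: "'a::euclidean_space set" and n :: nat
  assumes "n \<ge> 1" and "DIM('a) = n + 1"
    and "R \<in> nondegenerate_reflectors"
  shows "(closed_convex_hypersurface (directrix R) \<and>
            0 \<in> interior (body_bounded_by (directrix R))) \<and>
         ((\<forall>y q. supporting_paraboloid y q R \<longrightarrow>
              supporting_hyperplane (directrix R) (directrix_hyperplane y q) (- y)) \<and>
          {H. \<exists>u. supporting_hyperplane (directrix R) H u} =
            {directrix_hyperplane y q | y q. supporting_paraboloid y q R}) \<and>
         (\<forall>y\<in>sphere 0 1. support_function (directrix R) (- y) = focal_function R y) \<and>
         (bij_betw (\<lambda>u. (2 * support_function R u) *\<^sub>R u) (sphere 0 1) (directrix R) \<and>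
          C1_immersion_of_sphere (\<lambda>u. (2 * support_function R u) *\<^sub>R u))"
proof -
  obtain B where R: "R = frontier B" and "reflector_body B"
    using nondegenerate_reflector_body[of R] assms by auto
  then interpret reflector_body B "\<lambda>y. SUP X\<in>B. norm X - X \<bullet> y" "\<lambda>u. SUP X\<in>B. X \<bullet> u"
    by simp_all
  have "closed_convex_hypersurface (directrix R) \<and> 0 \<in> interior (body_bounded_by (directrix R))"
    using convex_body_directrix_body zero_interior_directrix_body
    by (auto simp: R directrix_eq_frontier_directrix_body body_bounded_by_frontier closed_convex_hypersurface_def)
  moreover have supp: "supporting_hyperplane (directrix R) (directrix_hyperplane y q) (- y)"
    if "supporting_paraboloid y q R" for y q
    using that directrix_hyperplane_eq[of y]
    by (simp add: R supporting_paraboloid_iff directrix_eq_frontier_directrix_body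
        supporting_hyperplane_directrix_iff)
  moreover have "{H. \<exists>u. supporting_hyperplane (directrix R) H u} =
      {directrix_hyperplane y q | y q. supporting_paraboloid y q R}"
  proof (intro equalityI subsetI)
    fix H assume "H \<in> {H. \<exists>u. supporting_hyperplane (directrix R) H u}"
    then obtain u where u: "norm u = 1" "H = {Z. Z \<bullet> u = (SUP X\<in>B. norm X - X \<bullet> (- u))}"
      by (auto simp: R directrix_eq_frontier_directrix_body supporting_hyperplane_directrix_iff)
    then have "H = directrix_hyperplane (- u) (ennreal (SUP X\<in>B. norm X - X \<bullet> (- u)))"
      using directrix_hyperplane_eq[of "- u"] by simp
    moreover have "supporting_paraboloid (- u) (ennreal (SUP X\<in>B. norm X - X \<bullet> (- u))) R"
      using u(1) by (simp add: R supporting_paraboloid_iff)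
    ultimately show "H \<in> {directrix_hyperplane y q | y q. supporting_paraboloid y q R}" by blast
  qed (use supp in blast)
  moreover have "\<forall>y\<in>sphere 0 1. support_function (directrix R) (- y) = focal_function R y"
    by (simp add: R directrix_eq_frontier_directrix_body support_function_directrix focal_function_eq)
  moreover have "bij_betw (\<lambda>u. (2 * support_function R u) *\<^sub>R u) (sphere 0 1) (directrix R)"
    using inj_on_parametrization
    by (simp add: R directrix_eq_frontier_directrix_body bij_betw_def support_function_eq frontier_directrix_body)
  moreover have "C1_immersion_of_sphere (\<lambda>u. (2 * support_function R u) *\<^sub>R u)"
    using C1_immersion_parametrization by (simp add: R support_function_eq)
  ultimately show ?thesis by blast
qed

end
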